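(* Let $M=(\mathbb{R}/2\pi\mathbb{Z})^2$ be the flat two-dimensional torus with coordinates $z=(x,y)^T$. Let $\eta\in C^\infty(\mathbb{R}/2\pi\mathbb{Z})$ satisfy $\eta(s)>0$ for $s\in[0,\pi/4)\cup(3\pi/4,5\pi/4)\cup(7\pi/4,2\pi]$ and $\eta(s)=0$ for $s\in[\pi/4,3\pi/4]\cup[5\pi/4,7\pi/4]$. Define vector fields on $M$ by $$V(x,y)=\begin{pmatrix}0\\(1-\cos x)\sin y\end{pmatrix},\qquad X_1(x,y)=\begin{pmatrix}1\\0\end{pmatrix},\qquad X_2(x,y)=\begin{pmatrix}0\\ \eta(y)\end{pmatrix}.$$ Then the system $\dot z=V(z)+u_1(t)X_1(z)+u_2(t)X_2(z)$ is not controllable in $M$.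
   Context: The system $\dot z=V(z)+u_1(t)X_1(z)+u_2(t)X_2(z)$ is called controllable in $M$ if for every pair of points $p,q\in M$ there exist $T>0$, piecewise continuous functions $u_1,u_2:[0,T]\to\mathbb{R}$ (of arbitrary size), and a solution $z:[0,T]\to M$ of the system with $z(0)=p$ and $z(T)=q$. *)

theory Defs
  imports "HOL-Analysis.Analysis"
begin

text \<open>The circle \<open>\<real> / 2\<pi>\<int>\<close>.\<close>

definition eq_mod_2pi :: "real \<Rightarrow> real \<Rightarrow> bool" where
  "eq_mod_2pi x y \<longleftrightarrow> (\<exists>k::int. x - y = 2 * pi * of_int k)"

lemma equivp_eq_mod_2pi: "equivp eq_mod_2pi"
proof (rule equivpI)
  show "reflp eq_mod_2pi"
    by (rule reflpI) (auto simp: eq_mod_2pi_def intro: exI[of _ 0])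
  show "symp eq_mod_2pi"
  proof (rule sympI)
    fix x y assume "eq_mod_2pi x y"
    then obtain k :: int where "x - y = 2 * pi * of_int k"
      by (auto simp: eq_mod_2pi_def)
    hence "y - x = 2 * pi * of_int (- k)" by simp
    thus "eq_mod_2pi y x" unfolding eq_mod_2pi_def by blast
  qed
  show "transp eq_mod_2pi"
  proof (rule transpI)
    fix x y z assume "eq_mod_2pi x y" "eq_mod_2pi y z"
    then obtain k l :: int where "x - y = 2 * pi * of_int k" "y - z = 2 * pi * of_int l"
      by (auto simp: eq_mod_2pi_def)
    hence "x - z = 2 * pi * of_int (k + l)" by (simp add: algebra_simps)
    thus "eq_mod_2pi x z" unfolding eq_mod_2pi_def by blast
  qed
qed

quotient_type circle = real / eq_mod_2pi
  morphisms rep_circle to_circle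
  by (rule equivp_eq_mod_2pi)

text \<open>The quotient topology; the product instance then gives the topology of the torus.\<close>

instantiation circle :: topological_space
begin

definition open_circle :: "circle set \<Rightarrow> bool" where
  "open_circle U \<longleftrightarrow> open (to_circle -` U)"

instance
  by standard (auto simp: open_circle_def vimage_Union)

end

type_synonym torus = "circle \<times> circle"

definition to_torus :: "real \<times> real \<Rightarrow> torus" where
  "to_torus = map_prod to_circle to_circle"

lift_definition circle_sin :: "circle \<Rightarrow> real" is sin
proof -
  fix x y assume "eq_mod_2pi x y"
  then obtain k :: int where "x = y + 2 * pi * of_int k"
    by (auto simp: eq_mod_2pi_def algebra_simps)
  thus "sin x = sin y" by (simp only: sin_add sin_int_2pin cos_int_2pin mult_1_right mult_zero_right add_0_right diff_zero)
qed

lift_definition circle_cos :: "circle \<Rightarrow> real" is cos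
proof -
  fix x y assume "eq_mod_2pi x y"
  then obtain k :: int where "x = y + 2 * pi * of_int k"
    by (auto simp: eq_mod_2pi_def algebra_simps)
  thus "cos x = cos y" by (simp only: cos_add sin_int_2pin cos_int_2pin mult_1_right mult_zero_right add_0_right diff_zero)
qed

text \<open>Smooth functions on the circle are the functions whose pullback to \<open>\<real>\<close> is smooth.\<close>

definition smooth_on_circle :: "(circle \<Rightarrow> real) \<Rightarrow> bool" where
  "smooth_on_circle f \<longleftrightarrow>
     (\<forall>n x. (deriv ^^ n) (\<lambda>s. f (to_circle s)) differentiable (at x))"

text \<open>
  The translation-invariant frame identifies every tangent space of the torus with \<open>\<real>\<^sup>2\<close>,
  so that vector fields are maps into \<open>\<real>\<^sup>2\<close>. The inverses of local restrictions
  of the covering \<open>to_torus\<close> are the charts of the torus: a curve has velocity \<open>v\<close> at \<open>t\<close> if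
  a lift of it near \<open>t\<close> has derivative \<open>v\<close> there. Outside of \<open>U\<close>, the function \<open>w\<close>
  below is irrelevant.
\<close>

definition has_velocity :: "(real \<Rightarrow> torus) \<Rightarrow> real \<times> real \<Rightarrow> real \<Rightarrow> real set \<Rightarrow> bool" where
  "has_velocity z v t S \<longleftrightarrow>
     (\<exists>w U. open U \<and> t \<in> U \<and> (\<forall>s \<in> S \<inter> U. z s = to_torus (w s)) \<and>
            (w has_vector_derivative v) (at t within S))"

text \<open>Finitely many discontinuities, at each of which the one-sided limits exist and are finite.\<close>

definition piecewise_continuous :: "real \<Rightarrow> real \<Rightarrow> (real \<Rightarrow> real) \<Rightarrow> bool" where
  "piecewise_continuous a b u \<longleftrightarrow>
     (\<exists>F. finite F \<and> (\<forall>t \<in> {a..b} - F. continuous (at t within {a..b}) u)) \<and>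
     (\<forall>t \<in> {a..<b}. \<exists>l. (u \<longlongrightarrow> l) (at_right t)) \<and>
     (\<forall>t \<in> {a<..b}. \<exists>l. (u \<longlongrightarrow> l) (at_left t))"

text \<open>
  As the controls may jump, a solution is continuous and satisfies the differential equation
  at all but finitely many times.
\<close>

definition solution ::
  "(torus \<Rightarrow> real \<times> real) \<Rightarrow> (torus \<Rightarrow> real \<times> real) \<Rightarrow> (torus \<Rightarrow> real \<times> real) \<Rightarrow>
   (real \<Rightarrow> real) \<Rightarrow> (real \<Rightarrow> real) \<Rightarrow> real \<Rightarrow> (real \<Rightarrow> torus) \<Rightarrow> bool" where
  "solution V X\<^sub>1 X\<^sub>2 u\<^sub>1 u\<^sub>2 T z \<longleftrightarrow>
     continuous_on {0..T} z \<and>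
     (\<exists>F. finite F \<and>
        (\<forall>t \<in> {0..T} - F.
           has_velocity z (V (z t) + u\<^sub>1 t *\<^sub>R X\<^sub>1 (z t) + u\<^sub>2 t *\<^sub>R X\<^sub>2 (z t)) t {0..T}))"

definition controllable ::
  "(torus \<Rightarrow> real \<times> real) \<Rightarrow> (torus \<Rightarrow> real \<times> real) \<Rightarrow> (torus \<Rightarrow> real \<times> real) \<Rightarrow> bool" where
  "controllable V X\<^sub>1 X\<^sub>2 \<longleftrightarrow>
     (\<forall>p q. \<exists>T>0. \<exists>u\<^sub>1 u\<^sub>2 z.
        piecewise_continuous 0 T u\<^sub>1 \<and> piecewise_continuous 0 T u\<^sub>2 \<and>
        solution V X\<^sub>1 X\<^sub>2 u\<^sub>1 u\<^sub>2 T z \<and> z 0 = p \<and> z T = q)"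

end

theory Submission
  imports Defs
begin

text \<open>
  The cosine of the second coordinate is an obstruction. Along a solution,
  \<open>(cos y)' = - (1 - cos x) sin\<^sup>2 y - u\<^sub>2 \<eta>(y) sin y\<close>. Where \<open>0 \<le> cos y \<le> cos (\<pi>/4)\<close>, the function
  \<open>\<eta>\<close> vanishes, so the second control is switched off and \<open>cos y\<close> cannot increase, whatever the
  controls do. A continuous function can only climb through a band of values by increasing inside
  it (\<open>no_ascent_through_band\<close>), so no solution leads from \<open>y = \<pi>\<close>, where \<open>cos y = -1\<close>, to \<open>y = 0\<close>,
  where \<open>cos y = 1\<close>. Unlike the angle \<open>y\<close>, its cosine is a single-valued continuous function on the
  torus, so the argument can be run on the solution itself, with lifts entering only locally, in
  the chain rule (\<open>has_velocity_imp_deriv_circle_cos\<close>).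
\<close>

text \<open>
  Between the last time at which \<open>f\<close> is below the band and the first later time at which it is above
  the band, all values lie in the band. There \<open>f\<close> is non-increasing, as the finitely many exceptional
  points do not matter to a continuous function: this contradicts the values at the two ends.
\<close>

lemma no_ascent_through_band:
  fixes f :: "real \<Rightarrow> real"
  assumes "a \<le> b" and cont: "continuous_on {a..b} f" and "finite F"
    and "f a \<le> lo" "lo < hi"
    and deriv: "\<And>t. t \<in> {a<..<b} - F \<Longrightarrow> f t \<in> {lo..hi} \<Longrightarrow>
                  \<exists>d\<le>0. (f has_real_derivative d) (at t)"
  shows "f b < hi"
proof (rule ccontr)
  assume "\<not> f b < hi"
  define A where "A = {x \<in> {a..b}. f x \<le> lo}"
  have "closed A"
    unfolding A_def by (intro continuous_on_closed_Collect_le cont continuous_intros closed_atLeastAtMost)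
  hence "compact A"
    by (metis (lifting) A_def bounded_closed_interval bounded_subset compact_eq_bounded_closed mem_Collect_eq subsetI)
  moreover have "a \<in> A" using assms by (simp add: A_def)
  ultimately obtain s where "s \<in> A" and s_last: "\<And>x. x \<in> A \<Longrightarrow> x \<le> s"
    using compact_attains_sup[of A] by blast
  hence s: "a \<le> s" "s \<le> b" "f s \<le> lo" by (auto simp: A_def)
  define B where "B = {x \<in> {s..b}. hi \<le> f x}"
  have cont_s: "continuous_on {s..b} f"
    by (rule continuous_on_subset[OF cont]) (use s in auto)
  have "closed B"
    unfolding B_def by (intro continuous_on_closed_Collect_le cont_s continuous_intros closed_atLeastAtMost)
  hence "compact B"
    by (metis (lifting) B_def bounded_closed_interval bounded_subset compact_eq_bounded_closed mem_Collect_eq subsetI)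
  moreover have "b \<in> B" using \<open>\<not> f b < hi\<close> s by (simp add: B_def)
  ultimately obtain t where "t \<in> B" and t_first: "\<And>x. x \<in> B \<Longrightarrow> t \<le> x"
    using compact_attains_inf[of B] by blast
  hence t: "s \<le> t" "t \<le> b" "hi \<le> f t" by (auto simp: B_def)
  have "\<exists>d\<le>0. (f has_real_derivative d) (at x)" if "x \<in> {s<..<t} - F" for x
  proof (rule deriv)
    show "x \<in> {a<..<b} - F" using that s t by auto
    have "x \<notin> A" "x \<notin> B" using that s_last[of x] t_first[of x] by auto
    thus "f x \<in> {lo..hi}" using that s t by (auto simp: A_def B_def)
  qed
  then obtain f' where f': "\<And>x. x \<in> {s<..<t} - F \<Longrightarrow> f' x \<le> 0 \<and> (f has_real_derivative f' x) (at x)"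
    by metis
  \<comment> \<open>The integrand is normalised to be non-positive at the exceptional points too.\<close>
  define g where "g x = (if x \<in> {s<..<t} - F then f' x else 0)" for x
  have "(g has_integral f t - f s) {s..t}"
  proof (rule fundamental_theorem_of_calculus_interior_strong[OF \<open>finite F\<close> \<open>s \<le> t\<close>])
    show "continuous_on {s..t} f"
      by (rule continuous_on_subset[OF cont_s]) (use t in auto)
  qed (use f' in \<open>auto simp: g_def has_real_derivative_iff_has_vector_derivative\<close>)
  hence "f t - f s \<le> 0"
    by (rule has_integral_le[OF _ has_integral_0]) (use f' in \<open>auto simp: g_def\<close>)
  thus False using s t \<open>lo < hi\<close> by linarith
qed

lemma continuous_on_circle_cos: "continuous_on A circle_cos"
proof -
  have "open (circle_cos -` B)" if "open B" for B
  proof -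
    have "to_circle -` circle_cos -` B = cos -` B"
      by (auto simp: circle_cos.abs_eq)
    moreover have "open (cos -` B :: real set)"
      using that by (intro open_vimage continuous_intros) auto
    ultimately show ?thesis by (simp add: open_circle_def)
  qed
  hence "continuous_on UNIV circle_cos"
    by (simp add: continuous_on_open_vimage)
  thus ?thesis by (rule continuous_on_subset) simp
qed

lemma circle_cases:
  obtains s where "s \<in> {0..<2*pi}" "y = to_circle s"
proof -
  obtain r where r: "y = to_circle r"
    by (metis Quotient_circle Quotient_abs_rep)
  define k where "k = \<lfloor>r / (2*pi)\<rfloor>"
  have "of_int k \<le> r / (2*pi)" "r / (2*pi) < of_int k + 1"
    unfolding k_def by linarith+
  hence "r - 2 * pi * of_int k \<in> {0..<2*pi}"
    by (simp add: field_simps)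
  moreover have "y = to_circle (r - 2 * pi * of_int k)"
    unfolding r circle.abs_eq_iff eq_mod_2pi_def by (auto intro: exI[of _ k])
  ultimately show ?thesis by (rule that)
qed

lemma circle_cos_in_band_imp_arc:
  assumes "0 \<le> circle_cos y" "circle_cos y \<le> cos (pi/4)"
  obtains s where "s \<in> {pi/4..3*pi/4} \<union> {5*pi/4..7*pi/4}" "y = to_circle s"
proof -
  obtain s where s: "s \<in> {0..<2*pi}" "y = to_circle s" by (rule circle_cases)
  \<comment> \<open>Reflecting at \<open>\<pi>\<close> moves the lower half of the circle to the range where \<open>cos\<close> is monotone.\<close>
  define r where "r = (if s \<le> pi then s else 2*pi - s)"
  have r: "0 \<le> r" "r \<le> pi" using s by (auto simp: r_def)
  have "cos r = circle_cos y" by (simp add: r_def s circle_cos.abs_eq)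
  hence "cos (pi/2) \<le> cos r" "cos r \<le> cos (pi/4)" using assms by auto
  hence "pi/4 \<le> r" "r \<le> pi/2"
    using r cos_mono_le_eq[of "pi/2" r] cos_mono_le_eq[of r "pi/4"] by auto
  hence "s \<in> {pi/4..3*pi/4} \<union> {5*pi/4..7*pi/4}"
    by (auto simp: r_def split: if_splits)
  thus ?thesis using s(2) by (rule that)
qed

text \<open>
  The chain rule in a local lift. At an interior point of \<open>S\<close>, the lift represents the curve on a full
  neighbourhood, which turns the derivative within \<open>S\<close> into a two-sided one.
\<close>

lemma has_velocity_imp_deriv_circle_cos:
  assumes "has_velocity z v t S" "t \<in> interior S"
  shows "((\<lambda>s. circle_cos (snd (z s))) has_real_derivative
           - circle_sin (snd (z t)) * snd v) (at t)"
proof -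
  obtain w U where U: "open U" "t \<in> U" and zw: "\<And>s. s \<in> S \<inter> U \<Longrightarrow> z s = to_torus (w s)"
    and w: "(w has_vector_derivative v) (at t within S)"
    using assms(1) unfolding has_velocity_def by blast
  have "t \<in> S" using assms(2) interior_subset by blast
  have "(w has_vector_derivative v) (at t)"
    using w at_within_interior[OF assms(2)] by simp
  hence "((\<lambda>s. snd (w s)) has_real_derivative snd v) (at t)"
    unfolding has_real_derivative_iff_has_vector_derivative
    by (rule bounded_linear.has_vector_derivative[OF bounded_linear_snd])
  hence "((\<lambda>s. cos (snd (w s))) has_real_derivative - sin (snd (w t)) * snd v) (at t)"
    by (auto intro!: derivative_eq_intros)
  moreover have "sin (snd (w t)) = circle_sin (snd (z t))"
    using zw[of t] U \<open>t \<in> S\<close> by (simp add: to_torus_def circle_sin.abs_eq)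
  ultimately have "((\<lambda>s. cos (snd (w s))) has_real_derivative - circle_sin (snd (z t)) * snd v) (at t)"
    by simp
  thus ?thesis
  proof (rule has_field_derivative_transform_within_open)
    show "open (interior S \<inter> U)" using U by auto
    show "t \<in> interior S \<inter> U" using assms U by auto
    show "cos (snd (w s)) = circle_cos (snd (z s))" if "s \<in> interior S \<inter> U" for s
    proof -
      have "s \<in> S \<inter> U" using that interior_subset by blast
      thus ?thesis using zw[of s] by (simp add: to_torus_def circle_cos.abs_eq)
    qed
  qed
qed

theorem theorem6p3:
  fixes \<eta> :: "circle \<Rightarrow> real"
    and V X\<^sub>1 X\<^sub>2 :: "torus \<Rightarrow> real \<times> real"
  assumes "smooth_on_circle \<eta>"
    and "\<And>s. s \<in> {0..<pi/4} \<union> {3*pi/4<..<5*pi/4} \<union> {7*pi/4<..2*pi} \<Longrightarrow> \<eta> (to_circle s) > 0"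
    and "\<And>s. s \<in> {pi/4..3*pi/4} \<union> {5*pi/4..7*pi/4} \<Longrightarrow> \<eta> (to_circle s) = 0"
    and "V = (\<lambda>(x, y). (0, (1 - circle_cos x) * circle_sin y))"
    and "X\<^sub>1 = (\<lambda>(x, y). (1, 0))"
    and "X\<^sub>2 = (\<lambda>(x, y). (0, \<eta> y))"
  shows "\<not> controllable V X\<^sub>1 X\<^sub>2"
proof
  assume "controllable V X\<^sub>1 X\<^sub>2"
  then obtain T u\<^sub>1 u\<^sub>2 z where "T > 0" and sol: "solution V X\<^sub>1 X\<^sub>2 u\<^sub>1 u\<^sub>2 T z"
    and z0: "z 0 = to_torus (0, pi)" and zT: "z T = to_torus (0, 0)"
    unfolding controllable_def by meson
  obtain F where "finite F" and vel: "\<And>t. t \<in> {0..T} - F \<Longrightarrow>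
      has_velocity z (V (z t) + u\<^sub>1 t *\<^sub>R X\<^sub>1 (z t) + u\<^sub>2 t *\<^sub>R X\<^sub>2 (z t)) t {0..T}"
    and cont: "continuous_on {0..T} z"
    using sol unfolding solution_def by blast
  define c where "c t = circle_cos (snd (z t))" for t
  have "c T < cos (pi/4)"
  proof (rule no_ascent_through_band[where f = c and a = 0 and lo = 0 and F = F])
    show "continuous_on {0..T} c"
      unfolding c_def
      by (rule continuous_on_compose2[OF continuous_on_circle_cos continuous_on_snd[OF cont] order_refl])
    show "c 0 \<le> 0" by (simp add: c_def z0 to_torus_def circle_cos.abs_eq)
    show "0 < cos (pi/4)" by (simp add: cos_45)
    fix t assume t: "t \<in> {0<..<T} - F" and "c t \<in> {0..cos (pi/4)}"
    then obtain s where "s \<in> {pi/4..3*pi/4} \<union> {5*pi/4..7*pi/4}" "snd (z t) = to_circle s"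
      using circle_cos_in_band_imp_arc[of "snd (z t)"] by (auto simp: c_def)
    hence \<eta>0: "\<eta> (snd (z t)) = 0" using assms(3) by metis
    define d where "d = - circle_sin (snd (z t)) * ((1 - circle_cos (fst (z t))) * circle_sin (snd (z t)))"
    have "circle_cos x \<le> 1" for x by transfer simp
    hence "d \<le> 0" by (auto simp: d_def mult.left_commute[of "circle_sin _"])
    moreover have "(c has_real_derivative d) (at t)"
      using has_velocity_imp_deriv_circle_cos[OF vel[of t]] t \<eta>0
      by (auto simp: c_def[abs_def] d_def assms(4-6) case_prod_beta)
    ultimately show "\<exists>d\<le>0. (c has_real_derivative d) (at t)" by blast
  qed (use \<open>T > 0\<close> \<open>finite F\<close> in auto)
  moreover have "c T = 1" by (simp add: c_def zT to_torus_def circle_cos.abs_eq)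
  ultimately show False using cos_le_one[of "pi/4"] by linarith
qed

end
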